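(* Let $\sigma\ge\tau\ge1$ be real numbers with $\sigma>1$, and put $\alpha_\star^{(\sigma)}=\sigma^{\sigma/(\sigma-1)}$. For any $(\tau,\sigma)$-elastic cost function $f$, no online algorithm for OACC with cost function $f$ can achieve a competitive ratio of $\alpha_\star^{(\sigma)}-\epsilon$ for any $\epsilon>0$.
   Context: OACC (online allocation with convex costs). There are $m\ge 1$ offline supply nodes, all with the same cost function $f:\mathbb{R}_+\to\mathbb{R}_+$. An instance $I$ is a finite sequence $(\mathbf v_1,\mathbf w_1),\dots,(\mathbf v_T,\mathbf w_T)$ with $\mathbf v_t=(v_{t,j})_{j\in[m]}$, $v_{t,j}\ge 0$, $\mathbf w_t=(w_{t,j})_{j\in[m]}$, $w_{t,j}>0$. When demand $t$ arrives, an irrevocable allocation $\mathbf x_t\in\mathcal X=\{\mathbf x\in\mathbb{R}_+^m:\sum_j x_j\le 1\}$ must be chosen. The objective is $\sum_{t}\sum_j v_{t,j}x_{t,j}-\sum_j f\big(\sum_t w_{t,j}x_{t,j}\big)$. $\mathrm{OPT}(I)$ is the offline maximum; $\mathrm{ALG}(I)$ is the value obtained by an online algorithm, i.e. one that knows $f$ upfront but has no prior knowledge of $I$ (including $T$), so that $\mathbf x_t$ depends only on $f$, $m$ and the first $t$ arrivals. The competitive ratio of an online algorithm is the maximum of $\mathrm{OPT}(I)/\mathrm{ALG}(I)$ over all instances $I$. Elasticity: $Ef'(y)=y f''(y)/f'(y)$ for $y>0$. A function $f:\mathbb{R}_+\to\mathbb{R}_+$ is $(\tau,\sigma)$-elastic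 if it is increasing, smooth, strictly convex, analytic at the origin, $f(0)=f'(0)=0$, $Ef'$ is non-decreasing on $(0,\infty)$, and $\tau-1\le Ef'(y)\le\sigma-1$ for all $y>0$.
   Formalization: The formal theorem additionally assumes that σ−1 is the exact supremum of Ef' over y>0; with a slack σ the claim is false, e.g. f(y)=y² is (2,3)-elastic, yet for m=1 a 4-competitive algorithm exists and 4 < 3^{3/2}. *)

theory Defs
  imports "HOL-Analysis.Analysis"
begin

section \<open>Elastic cost functions\<close>

text \<open>Cost functions live on the non-negative reals. They are represented by total functions
  on the reals whose values at negative arguments are irrelevant: every condition below only
  looks at \<^term>\<open>{0..}\<close>, or at \<^term>\<open>deriv\<close> taken at positive points.\<close>

definition smooth_on_nonneg :: "(real \<Rightarrow> real) \<Rightarrow> bool" where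
  "smooth_on_nonneg f \<longleftrightarrow>
     (\<exists>D :: nat \<Rightarrow> real \<Rightarrow> real. (\<forall>y\<ge>0. D 0 y = f y) \<and>
        (\<forall>k. \<forall>y\<ge>0. (D k has_real_derivative D (Suc k) y) (at y within {0..})))"

definition strictly_convex_on :: "real set \<Rightarrow> (real \<Rightarrow> real) \<Rightarrow> bool" where
  "strictly_convex_on S f \<longleftrightarrow> convex S \<and>
     (\<forall>x\<in>S. \<forall>y\<in>S. \<forall>u. x \<noteq> y \<longrightarrow> 0 < u \<longrightarrow> u < 1 \<longrightarrow>
        f ((1 - u) * x + u * y) < (1 - u) * f x + u * f y)"

definition analytic_at_origin :: "(real \<Rightarrow> real) \<Rightarrow> bool" where
  "analytic_at_origin f \<longleftrightarrow>
     (\<exists>a r. 0 < r \<and> (\<forall>y. 0 \<le> y \<longrightarrow> y < r \<longrightarrow> (\<lambda>n. a n * y ^ n) sums f y))"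

definition elasticity :: "(real \<Rightarrow> real) \<Rightarrow> real \<Rightarrow> real" where
  "elasticity g y = y * deriv g y / g y"

definition elastic :: "real \<Rightarrow> real \<Rightarrow> (real \<Rightarrow> real) \<Rightarrow> bool" where
  "elastic \<tau> \<sigma> f \<longleftrightarrow>
     (\<forall>y\<ge>0. 0 \<le> f y) \<and>
     strict_mono_on {0..} f \<and>
     smooth_on_nonneg f \<and>
     strictly_convex_on {0..} f \<and>
     analytic_at_origin f \<and>
     f 0 = 0 \<and> (f has_real_derivative 0) (at 0 within {0..}) \<and>
     mono_on {0<..} (elasticity (deriv f)) \<and>
     (\<forall>y>0. \<tau> - 1 \<le> elasticity (deriv f) y \<and> elasticity (deriv f) y \<le> \<sigma> - 1)"

definition alpha_star :: "real \<Rightarrow> real" where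
  "alpha_star \<sigma> = \<sigma> powr (\<sigma> / (\<sigma> - 1))"


section \<open>Online allocation with convex costs\<close>

text \<open>The supply nodes are the elements of a finite (hence non-empty) type \<^typ>\<open>'n\<close>,
  so the number of nodes is \<open>CARD('n)\<close>. A demand is the pair of its value vector
  and its weight vector.\<close>

type_synonym 'n demand = "(real ^ 'n) \<times> (real ^ 'n)"

definition valid_instance :: "'n::finite demand list \<Rightarrow> bool" where
  "valid_instance I \<longleftrightarrow> (\<forall>(v, w)\<in>set I. \<forall>j. 0 \<le> v $ j \<and> 0 < w $ j)"

definition allocs :: "(real ^ 'n::finite) set" where
  "allocs = {x. (\<forall>j. 0 \<le> x $ j) \<and> (\<Sum>j\<in>UNIV. x $ j) \<le> 1}"

definition objective ::
  "(real \<Rightarrow> real) \<Rightarrow> 'n::finite demand list \<Rightarrow> (real ^ 'n) list \<Rightarrow> real" where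
  "objective f I xs =
     (\<Sum>t<length I. \<Sum>j\<in>UNIV. fst (I ! t) $ j * (xs ! t) $ j)
     - (\<Sum>j\<in>UNIV. f (\<Sum>t<length I. snd (I ! t) $ j * (xs ! t) $ j))"

text \<open>For a continuous non-negative cost function the supremum is a maximum: the set of
  feasible allocations is non-empty and compact.\<close>

definition OPT :: "(real \<Rightarrow> real) \<Rightarrow> 'n::finite demand list \<Rightarrow> real" where
  "OPT f I = (SUP xs \<in> {xs. length xs = length I \<and> set xs \<subseteq> allocs}. objective f I xs)"

text \<open>A deterministic online algorithm maps the non-empty sequence of arrivals seen so far to the
  allocation of the latest one.\<close>

type_synonym 'n algorithm = "'n demand list \<Rightarrow> real ^ 'n"

definition online_algorithm :: "'n::finite algorithm \<Rightarrow> bool" where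
  "online_algorithm A \<longleftrightarrow> (\<forall>I. I \<noteq> [] \<longrightarrow> valid_instance I \<longrightarrow> A I \<in> allocs)"

definition run :: "'n::finite algorithm \<Rightarrow> 'n demand list \<Rightarrow> (real ^ 'n) list" where
  "run A I = map (\<lambda>t. A (take (Suc t) I)) [0..<length I]"

definition ALG :: "(real \<Rightarrow> real) \<Rightarrow> 'n::finite algorithm \<Rightarrow> 'n demand list \<Rightarrow> real" where
  "ALG f A I = objective f I (run A I)"

text \<open>The quotient OPT/ALG with its degenerate cases fixed so that, for \<open>opt \<ge> 0\<close> and
  \<open>c \<ge> 1\<close>, \<open>perf_ratio opt alg \<le> c\<close> means \<open>opt \<le> c * alg\<close>. In particular
  an algorithm that gains nothing while the optimum is positive, or that makes a loss,
  has an infinite ratio (and not a negative one).\<close>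

definition perf_ratio :: "real \<Rightarrow> real \<Rightarrow> ereal" where
  "perf_ratio opt alg =
     (if 0 < alg then ereal (opt / alg)
      else if alg = 0 \<and> opt = 0 then 1
      else \<infinity>)"

definition competitive_ratio :: "(real \<Rightarrow> real) \<Rightarrow> 'n::finite algorithm \<Rightarrow> ereal" where
  "competitive_ratio f A = (SUP I \<in> {I. valid_instance I}. perf_ratio (OPT f I) (ALG f A I))"

end

(* Only one node receives values, so the others can be ignored. On a large scale f behaves like
   the power function y^sigma, for which we raise the unit price geometrically, offering each time
   the optimal quantity w_i at the current price p_i. Summation by parts turns the profit
   sum_k p_k s_k - f(S_i) of the algorithm into p_i S_i - G_i - f(S_i), where G_i accumulates
   S_k (p_{k+1} - p_k). If this profit were always more than a fraction 1/alpha_star of the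
   optimum, then G_i, measured relative to the optimum, would grow linearly in i although it is
   bounded. The instance is stopped at the first violation. *)

theory Submission
  imports Defs
begin

section \<open>Growth of elastic functions\<close>

text \<open>At positive points the one-sided derivatives from smoothness are ordinary ones.
  \<open>f'\<close> is \<open>D 1\<close> and not \<open>deriv f\<close> because continuity at 0 is
  needed, where the two need not agree.\<close>

lemma elasticE:
  assumes "elastic \<tau> \<sigma> f"
  obtains f' f'' where
    "continuous_on {0..} f" "continuous_on {0..} f'"
    "\<And>y. y > 0 \<Longrightarrow> (f has_real_derivative f' y) (at y)"
    "\<And>y. y > 0 \<Longrightarrow> (f' has_real_derivative f'' y) (at y)"
    "\<And>y. y > 0 \<Longrightarrow> elasticity (deriv f) y = y * f'' y / f' y"
proof -
  from assms obtain D where D0: "\<And>y. y \<ge> 0 \<Longrightarrow> D 0 y = f y"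
    and D: "\<And>k y. y \<ge> 0 \<Longrightarrow> (D k has_real_derivative D (Suc k) y) (at y within {0..})"
    unfolding elastic_def smooth_on_nonneg_def by blast
  have cont: "continuous_on {0..} (D k)" for k
    using D by (intro DERIV_continuous_on) auto
  have at: "(D k has_real_derivative D (Suc k) y) (at y)" if "y > 0" for k y
    using D[of y k] that at_within_interior[of y "{0..}"] by simp
  have f1: "(f has_real_derivative D 1 y) (at y)" if "y > 0" for y
  proof (rule has_field_derivative_transform_within_open)
    show "(D 0 has_real_derivative D 1 y) (at y)"
      using at[of y 0] that by simp
    show "open {0::real<..}" "y \<in> {0<..}"
      using that by auto
  qed (simp add: D0)
  have f2: "(deriv f has_real_derivative D 2 y) (at y)" if "y > 0" for y
  proof (rule has_field_derivative_transform_within_open)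
    show "(D 1 has_real_derivative D 2 y) (at y)"
      using at[of y 1] that by (simp add: numeral_2_eq_2)
    show "open {0::real<..}" "y \<in> {0<..}"
      using that by auto
  qed (use f1 DERIV_imp_deriv in force)
  show ?thesis
  proof
    show "continuous_on {0..} f"
      using cont[of 0] D0 by (metis atLeast_iff continuous_on_cong)
    show "continuous_on {0..} (D 1)"
      by (rule cont)
    show "(f has_real_derivative D 1 y) (at y)" if "y > 0" for y
      using f1 that .
    show "(D 1 has_real_derivative D 2 y) (at y)" if "y > 0" for y
      using at[of y 1] that by (simp add: numeral_2_eq_2)
    show "elasticity (deriv f) y = y * D 2 y / D 1 y" if "y > 0" for y
      using that by (simp add: elasticity_def DERIV_imp_deriv[OF f1] DERIV_imp_deriv[OF f2])
  qed
qed

lemma strictly_convex_on_imp_convex_on: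
  assumes "strictly_convex_on S f"
  shows "convex_on S f"
proof (rule convex_onI)
  show "convex S"
    using assms by (simp add: strictly_convex_on_def)
  show "f ((1 - t) *\<^sub>R x + t *\<^sub>R y) \<le> (1 - t) * f x + t * f y"
    if "0 < t" "t < 1" "x \<in> S" "y \<in> S" for t x y
  proof (cases "x = y")
    case True
    then show ?thesis
      by (simp add: algebra_simps)
  next
    case False
    then show ?thesis
      using assms that unfolding strictly_convex_on_def
      by (auto intro!: less_imp_le)
  qed
qed

section \<open>Comparison of elastic functions with powers\<close>

text \<open>The derivative of \<open>f u * u powr (-a)\<close> has the sign of
  \<open>u * f' u - a * f u\<close>. No sign of \<open>f\<close> is assumed, so the lemma applied to
  \<open>- f\<close> gives the reverse estimate.\<close>

lemma powr_comparison:
  fixes f f' :: "real \<Rightarrow> real"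
  assumes "0 < x" "x \<le> z"
    and deriv: "\<And>u. x \<le> u \<Longrightarrow> u \<le> z \<Longrightarrow> (f has_real_derivative f' u) (at u)"
    and le: "\<And>u. x \<le> u \<Longrightarrow> u \<le> z \<Longrightarrow> a * f u \<le> u * f' u"
  shows "f x * z powr a \<le> f z * x powr a"
proof -
  have "f x * x powr (-a) \<le> f z * z powr (-a)"
  proof (rule DERIV_nonneg_imp_nondecreasing[OF \<open>x \<le> z\<close>])
    fix u assume u: "x \<le> u" "u \<le> z"
    then have "u > 0"
      using assms by linarith
    have "((\<lambda>u. f u * u powr (-a)) has_real_derivative
        f' u * u powr (-a) + (-a) * u powr (-a - 1) * f u) (at u)"
      by (rule DERIV_mult[OF deriv[OF u] has_real_derivative_powr[OF \<open>u > 0\<close>]])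
    moreover have "u powr (-a) = u * u powr (-a - 1)"
      using \<open>u > 0\<close> powr_mult_base[of u "-a - 1"] by simp
    then have "f' u * u powr (-a) + (-a) * u powr (-a - 1) * f u
        = u powr (-a - 1) * (u * f' u - a * f u)"
      by (simp add: algebra_simps)
    moreover have "\<dots> \<ge> 0"
      using le[OF u] by simp
    ultimately show "\<exists>y. ((\<lambda>u. f u * u powr (-a)) has_real_derivative y) (at u) \<and> y \<ge> 0"
      by (metis (no_types, lifting))
  qed
  then show ?thesis
    using assms by (simp add: powr_minus field_simps)
qed

text \<open>The elasticity bounds on the derivative pass to \<open>f\<close> itself because
  \<open>y f' - a f\<close> has derivative \<open>f' (E f' + 1 - a)\<close>.\<close>

lemma elastic_growth:
  assumes el: "elastic \<tau> \<sigma> f"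
    and tight: "(SUP y\<in>{0<..}. elasticity (deriv f) y) = \<sigma> - 1"
  shows elastic_lower: "\<And>x y. 0 < x \<Longrightarrow> 0 \<le> y \<Longrightarrow> y \<le> 1 \<Longrightarrow> y powr \<sigma> * f x \<le> f (x * y)"
    and elastic_upper: "\<And>a. a < \<sigma> \<Longrightarrow>
      \<exists>Y>0. \<forall>x y. y \<le> 1 \<longrightarrow> Y \<le> x * y \<longrightarrow> 0 < x \<longrightarrow> f (x * y) \<le> y powr a * f x"
proof -
  obtain f' f'' where cont: "continuous_on {0..} f" "continuous_on {0..} f'"
    and f': "\<And>y. y > 0 \<Longrightarrow> (f has_real_derivative f' y) (at y)"
    and f'': "\<And>y. y > 0 \<Longrightarrow> (f' has_real_derivative f'' y) (at y)"
    and E: "\<And>y. y > 0 \<Longrightarrow> elasticity (deriv f) y = y * f'' y / f' y"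
    using elasticE[OF el] by blast
  have f0: "f 0 = 0" and mono: "strict_mono_on {0..} f"
    and Emono: "mono_on {0<..} (elasticity (deriv f))"
    and Ele: "\<And>y. y > 0 \<Longrightarrow> elasticity (deriv f) y \<le> \<sigma> - 1"
    and conv: "convex_on {0..} f"
    using el strictly_convex_on_imp_convex_on unfolding elastic_def by auto
  have fpos: "f y > 0" if "y > 0" for y
    using strict_mono_onD[OF mono, of 0 y] that f0 by simp
  \<comment> \<open>By convexity the tangent at \<open>y\<close> lies below the graph at 0, where
    \<open>f\<close> vanishes.\<close>
  have fle: "f y \<le> y * f' y" if "y > 0" for y
  proof -
    have "(f has_real_derivative f' y) (at y within {0..})"
      using f'[OF that] by (rule has_field_derivative_at_within)
    moreover have "y \<in> interior {0..}"
      using that by simp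
    ultimately have "f 0 - f y \<ge> f' y * (0 - y)"
      by (intro convex_on_imp_above_tangent[OF conv]) auto
    then show ?thesis
      by (simp add: f0 algebra_simps)
  qed
  have f'pos: "f' y > 0" if "y > 0" for y
    using fle[OF that] fpos[OF that] that by (metis less_le_trans zero_less_mult_pos)
  have contH: "continuous_on {0..} (\<lambda>y. y * f' y - a * f y)" for a
    by (intro continuous_intros cont)
  have derivH: "((\<lambda>y. y * f' y - a * f y) has_real_derivative y * f'' y + f' y - a * f' y) (at y)"
    if "y > 0" for a y
    by (rule derivative_eq_intros f' f'' that refl | simp)+
  have upper: "y * f' y \<le> \<sigma> * f y" if "y > 0" for y
  proof -
    \<comment> \<open>The function is 0 at the origin, and its continuity there lets the sign of the
      derivative at positive points suffice.\<close>
    have "0 * f' 0 - \<sigma> * f 0 \<ge> y * f' y - \<sigma> * f y"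
    proof (rule DERIV_nonpos_imp_decreasing_open[where f = "\<lambda>y. y * f' y - \<sigma> * f y"])
      show "continuous_on {0..y} (\<lambda>y. y * f' y - \<sigma> * f y)"
        by (rule continuous_on_subset[OF contH]) auto
      show "\<exists>z. ((\<lambda>y. y * f' y - \<sigma> * f y) has_real_derivative z) (at u) \<and> z \<le> 0"
        if "0 < u" "u < y" for u
        using derivH[OF \<open>0 < u\<close>, of \<sigma>] Ele[OF \<open>0 < u\<close>] f'pos[OF \<open>0 < u\<close>] E[OF \<open>0 < u\<close>]
        by (intro exI[of _ "u * f'' u + f' u - \<sigma> * f' u"]) (auto simp: field_simps)
    qed (use that in auto)
    then show ?thesis
      by (simp add: f0)
  qed
  show "y powr \<sigma> * f x \<le> f (x * y)" if "0 < x" "0 \<le> y" "y \<le> 1" for x y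
  proof (cases "y = 0")
    case False
    then have y: "y > 0"
      using that by simp
    have "- f (x * y) * x powr \<sigma> \<le> - f x * (x * y) powr \<sigma>"
    proof (rule powr_comparison[where f = "\<lambda>x. - f x" and f' = "\<lambda>x. - f' x"])
      fix u assume "x * y \<le> u"
      moreover have "x * y > 0"
        using that y by simp
      ultimately have "u > 0"
        by linarith
      then show "((\<lambda>x. - f x) has_real_derivative - f' u) (at u)" "\<sigma> * - f u \<le> u * - f' u"
        using f' upper by (auto intro: DERIV_minus)
    qed (use that y in \<open>auto simp: mult_left_le\<close>)
    then have "x powr \<sigma> * (y powr \<sigma> * f x) \<le> x powr \<sigma> * f (x * y)"
      using that y by (simp add: powr_mult algebra_simps)
    then show ?thesis
      using that by simp
  qed (simp add: f0)
  show "\<exists>Y>0. \<forall>x y. y \<le> 1 \<longrightarrow> Y \<le> x * y \<longrightarrow> 0 < x \<longrightarrow> f (x * y) \<le> y powr a * f x"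
    if "a < \<sigma>" for a
  proof -
    \<comment> \<open>From some point on the elasticity is at least \<open>b - 1\<close>. This
      leaves an additive constant \<open>C\<close>, possibly negative, which the gap
      \<open>b - a\<close> absorbs on a large scale.\<close>
    define b where "b = (a + \<sigma>) / 2"
    have b: "a < b" "b < \<sigma>"
      using that by (auto simp: b_def)
    have "bdd_above (elasticity (deriv f) ` {0<..})"
      using Ele by (intro bdd_aboveI[of _ "\<sigma> - 1"]) auto
    \<comment> \<open>The supremum is \<open>\<sigma> - 1 > b - 1\<close>, so some \<open>Z\<close>
      exceeds \<open>b - 1\<close>; monotonicity of the elasticity keeps the bound beyond
      \<open>Z\<close>.\<close>
    then obtain Z where Z: "Z > 0" "elasticity (deriv f) Z > b - 1"
      using less_cSUP_iff[of "{0<..}" "elasticity (deriv f)" "b - 1"] tight b by auto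
    have lowerE: "u * f'' u \<ge> (b - 1) * f' u" if "u \<ge> Z" for u
    proof -
      have "u > 0" using that Z by linarith
      have "elasticity (deriv f) u \<ge> b - 1"
        using mono_onD[OF Emono, of Z u] that Z \<open>u > 0\<close> by simp
      then show ?thesis
        using f'pos[OF \<open>u > 0\<close>] E[OF \<open>u > 0\<close>] by (simp add: field_simps)
    qed
    define C where "C = Z * f' Z - b * f Z"
    have lower: "y * f' y - b * f y \<ge> C" if "y \<ge> Z" for y
      unfolding C_def
    proof (rule DERIV_nonneg_imp_nondecreasing[OF that])
      fix u assume "Z \<le> u" "u \<le> y"
      then show "\<exists>z. ((\<lambda>y. y * f' y - b * f y) has_real_derivative z) (at u) \<and> z \<ge> 0"
        using derivH[of u b] lowerE[of u] Z
        by (intro exI[of _ "u * f'' u + f' u - b * f' u"]) (auto simp: algebra_simps)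
    qed
    \<comment> \<open>For \<open>y \<ge> 1\<close> convexity gives \<open>f y \<ge> f 1 * y\<close>;
      the last bound then makes \<open>(b - a) * f y\<close> at least \<open>- C\<close>.\<close>
    define Y where "Y = max (max 1 Z) (- C / ((b - a) * f 1))"
    have Y: "Y \<ge> 1" "Y \<ge> Z" "Y \<ge> - C / ((b - a) * f 1)"
      by (auto simp: Y_def)
    have main: "a * f y \<le> y * f' y" if "y \<ge> Y" for y
    proof -
      have y: "y \<ge> 1" using that Y by linarith
      have "f 1 * y powr 1 \<le> f y * 1 powr 1"
        by (rule powr_comparison[where f' = f']) (use y f' fle in auto)
      then have "f 1 * y \<le> f y"
        using y by simp
      moreover have "- C \<le> y * ((b - a) * f 1)"
      proof -
        have "(b - a) * f 1 > 0"
          using b fpos[of 1] by simp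
        then show ?thesis
          using order_trans[OF Y(3) that] pos_divide_le_eq by blast
      qed
      moreover have "(b - a) * (f 1 * y) \<le> (b - a) * f y"
        using calculation(1) b by (intro mult_left_mono) auto
      ultimately have "- C \<le> (b - a) * f y"
        by (simp add: algebra_simps)
      then show ?thesis
        using lower[of y] that Y by (simp add: algebra_simps)
    qed
    have "f (x * y) \<le> y powr a * f x" if "y \<le> 1" "Y \<le> x * y" "0 < x" for x y
    proof -
      have xy: "x * y > 0" using that Y by linarith
      then have y: "y > 0"
        using that by (simp add: zero_less_mult_iff)
      have "f (x * y) * x powr a \<le> f x * (x * y) powr a"
      proof (rule powr_comparison)
        show "x * y \<le> x"
          using that by (simp add: mult_left_le)
        show "(f has_real_derivative f' u) (at u)" "a * f u \<le> u * f' u" if "x * y \<le> u" for u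
          using that \<open>Y \<le> x * y\<close> xy by (auto intro!: main f')
      qed (use xy in auto)
      then have "x powr a * f (x * y) \<le> x powr a * (y powr a * f x)"
        using that y by (simp add: powr_mult algebra_simps)
      then show ?thesis
        using that by simp
    qed
    then show ?thesis
      using Y by (intro exI[of _ Y]) auto
  qed
qed

text \<open>Counterpart of \<open>elastic_lower\<close>: \<open>elastic_upper\<close> gives
  exponents just below \<open>\<sigma>\<close>, and on \<open>y \<ge> w\<close> the missing part of
  the exponent costs only a factor close to 1.\<close>

lemma elastic_asymptotic_power:
  assumes el: "elastic \<tau> \<sigma> f"
    and tight: "(SUP y\<in>{0<..}. elasticity (deriv f) y) = \<sigma> - 1"
    and "0 < w" "w < 1" "0 < \<delta>"
  obtains x where "0 < x" "\<And>y. w \<le> y \<Longrightarrow> y \<le> 1 \<Longrightarrow> f (x * y) \<le> (1 + \<delta>) * y powr \<sigma> * f x"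
proof -
  \<comment> \<open>Solves \<open>w powr (-\<eta>) = 1 + \<delta>\<close>.\<close>
  define \<eta> where "\<eta> = ln (1 + \<delta>) / - ln w"
  have \<eta>: "\<eta> > 0" and lnw: "ln w < 0"
    using assms by (auto simp: \<eta>_def zero_less_divide_iff divide_less_0_iff)
  then have w: "w powr (-\<eta>) = 1 + \<delta>"
    using assms by (simp add: powr_def \<eta>_def)
  have "\<sigma> - \<eta> < \<sigma>"
    using \<eta> by simp
  from elastic_upper[OF el tight this] obtain Y where "Y > 0"
    and Y: "\<And>x y. y \<le> 1 \<Longrightarrow> Y \<le> x * y \<Longrightarrow> 0 < x \<Longrightarrow> f (x * y) \<le> y powr (\<sigma> - \<eta>) * f x"
    by blast
  \<comment> \<open>The least scale at which \<open>x * y \<ge> Y\<close> for every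
    \<open>y \<ge> w\<close>.\<close>
  define x where "x = Y / w"
  have x: "x > 0"
    using \<open>Y > 0\<close> assms by (simp add: x_def)
  show ?thesis
  proof (rule that[OF x])
    fix y assume y: "w \<le> y" "y \<le> 1"
    have "Y \<le> x * y"
      using y \<open>Y > 0\<close> assms by (simp add: x_def field_simps)
    then have "f (x * y) \<le> y powr (\<sigma> - \<eta>) * f x"
      using Y x y by blast
    also have "y powr (\<sigma> - \<eta>) = y powr (-\<eta>) * y powr \<sigma>"
      by (simp flip: powr_add)
    also have "y powr (-\<eta>) * y powr \<sigma> * f x \<le> w powr (-\<eta>) * y powr \<sigma> * f x"
      using y \<eta> assms(3) el x
      by (intro mult_right_mono powr_mono2') (auto simp: elastic_def)
    finally show "f (x * y) \<le> (1 + \<delta>) * y powr \<sigma> * f x"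
      by (simp add: w)
  qed
qed

section \<open>The power cost function\<close>

lemma bernoulli_powr:
  fixes t a :: real
  assumes "1 \<le> a" "0 \<le> t"
  shows "1 + a * (t - 1) \<le> t powr a"
proof (cases "t = 0")
  case False
  \<comment> \<open>Weighted AM-GM for \<open>t powr a\<close> and 1 with weights
    \<open>1 / a\<close> and \<open>1 - 1 / a\<close>.\<close>
  have "(t powr a) powr (1 / a) * 1 powr (1 - 1 / a) \<le> 1 / a * t powr a + (1 - 1 / a) * 1"
    using assms False by (intro Youngs_inequality_0) auto
  then have "t \<le> (t powr a + a - 1) / a"
    using assms False by (simp add: powr_powr diff_divide_distrib add_divide_distrib)
  then have "t * a \<le> t powr a + a - 1"
    using assms by (simp add: pos_le_divide_eq)
  then show ?thesis
    by (simp add: algebra_simps)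
qed (use assms in simp)

text \<open>The source of \<open>alpha_star\<close>: the convex conjugate of
  \<open>t powr \<sigma>\<close> at slope \<open>q powr (\<sigma> - 1)\<close> is
  \<open>q powr \<sigma> * ((\<sigma> - 1) / alpha_star \<sigma>)\<close>.\<close>

lemma alpha_star_tangent:
  fixes t q \<sigma> :: real
  assumes "1 < \<sigma>" "0 \<le> t" "0 < q"
  shows "q powr (\<sigma> - 1) * t \<le> t powr \<sigma> + q powr \<sigma> * ((\<sigma> - 1) / alpha_star \<sigma>)"
proof -
  \<comment> \<open>the maximiser of \<open>q powr (\<sigma> - 1) * t - t powr \<sigma>\<close>\<close>
  define u where "u = q * \<sigma> powr (- (1 / (\<sigma> - 1)))"
  have u: "u > 0"
    using assms by (simp add: u_def)
  have u1: "\<sigma> * u powr (\<sigma> - 1) = q powr (\<sigma> - 1)"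
    using assms by (simp add: u_def powr_mult powr_divide powr_powr powr_minus_divide)
  have "u powr \<sigma> = q powr \<sigma> * \<sigma> powr (- (\<sigma> / (\<sigma> - 1)))"
    using assms by (simp add: u_def powr_mult powr_powr)
  then have u2: "u powr \<sigma> = q powr \<sigma> / alpha_star \<sigma>"
    by (simp add: alpha_star_def powr_minus_divide)
  have u3: "u powr \<sigma> = u * u powr (\<sigma> - 1)"
    using u powr_mult_base[of u "\<sigma> - 1"] by simp
  \<comment> \<open>Scaled by \<open>u powr \<sigma>\<close>, this is the tangent to the power
    function at \<open>u\<close>.\<close>
  have "1 + \<sigma> * (t / u - 1) \<le> (t / u) powr \<sigma>"
    using assms u by (intro bernoulli_powr) auto
  then have "u powr \<sigma> * (1 + \<sigma> * (t / u - 1)) \<le> u powr \<sigma> * (t / u) powr \<sigma>"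
    by (intro mult_left_mono) auto
  also have "u powr \<sigma> * (t / u) powr \<sigma> = t powr \<sigma>"
    using u assms by (simp flip: powr_mult)
  also have "u powr \<sigma> * (1 + \<sigma> * (t / u - 1)) = \<sigma> * u powr (\<sigma> - 1) * t - (\<sigma> - 1) * u powr \<sigma>"
    using u by (simp add: u3 field_simps)
  finally show ?thesis
    using u1 u2 by (simp add: algebra_simps)
qed

text \<open>The optimal quantity for the cost \<open>y powr \<sigma>\<close> at unit price \<open>\<sigma> * w powr (\<sigma> - 1)\<close> is
  \<open>w\<close>, with profit \<open>(\<sigma> - 1) * w powr \<sigma>\<close>. When the optimal quantity grows by the factor
  \<open>q\<close> in each step, the normalised revenue loss \<open>g\<close> below would have to increase by a
  constant at each step, although it never exceeds \<open>\<sigma> - 1\<close>.\<close>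

lemma power_game:
  fixes \<sigma> K :: real
  assumes "1 < \<sigma>" and K: "(\<sigma> - 1) / alpha_star \<sigma> < K"
  obtains q :: real and N :: nat where "1 < q"
    "\<And>w s. 0 < w \<Longrightarrow> (\<And>i. i \<le> N \<Longrightarrow> 0 \<le> s i) \<Longrightarrow>
      \<exists>i\<le>N. (\<Sum>k\<le>i. \<sigma> * (w * q ^ k) powr (\<sigma> - 1) * s k) - (\<Sum>k\<le>i. s k) powr \<sigma>
        < K * (w * q ^ i) powr \<sigma>"
proof -
  define L where "L = (\<sigma> - 1) / alpha_star \<sigma>"
  have L: "L > 0" "L < K"
    using assms by (auto simp: L_def alpha_star_def)
  \<comment> \<open>Puts \<open>q powr \<sigma>\<close> midway between 1 and \<open>K / L\<close>,
    so that \<open>q > 1\<close> but still \<open>q powr \<sigma> * L < K\<close>.\<close>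
  define q where "q = ((K / L + 1) / 2) powr (1 / \<sigma>)"
  have KL: "K / L > 1"
    using L by simp
  have q\<sigma>: "q powr \<sigma> = (K / L + 1) / 2"
    using KL assms by (simp add: q_def powr_powr)
  have q: "q > 1"
    unfolding q_def using KL assms by (intro gr_one_powr) auto
  define a where "a = q powr \<sigma> - 1"
  have a: "a > 0"
    using KL by (simp add: a_def q\<sigma>)
  \<comment> \<open>The guaranteed increase of \<open>g\<close> per step, proved in
    \<open>increase\<close>.\<close>
  define d where "d = a * (K - q powr \<sigma> * L) / q powr \<sigma>"
  have "q powr \<sigma> * L < K"
    using L unfolding q\<sigma> by (simp add: field_simps)
  then have d: "d > 0"
    using a q by (simp add: d_def)
  \<comment> \<open>By Bernoulli \<open>\<sigma> * t - t powr \<sigma> \<le> \<sigma> - 1\<close>,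
    so \<open>\<sigma> - 1 - K\<close> bounds \<open>g\<close>; after \<open>N\<close> steps of size
    \<open>d\<close> it is passed.\<close>
  obtain N :: nat where N: "\<sigma> - 1 - K < N * d"
    using d by (metis ex_less_of_nat_mult)
  show ?thesis
  proof (rule that[OF q], rule ccontr)
    fix w :: real and s :: "nat \<Rightarrow> real"
    assume w: "0 < w" and s: "\<And>i. i \<le> N \<Longrightarrow> 0 \<le> s i"
      and "\<not> (\<exists>i\<le>N. (\<Sum>k\<le>i. \<sigma> * (w * q ^ k) powr (\<sigma> - 1) * s k) - (\<Sum>k\<le>i. s k) powr \<sigma>
        < K * (w * q ^ i) powr \<sigma>)"
    then have profit: "K * (w * q ^ i) powr \<sigma>
      \<le> (\<Sum>k\<le>i. \<sigma> * (w * q ^ k) powr (\<sigma> - 1) * s k) - (\<Sum>k\<le>i. s k) powr \<sigma>" if "i \<le> N" for i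
      using that by (meson not_le)
    define W where "W i = w * q ^ i" for i
    have W: "W i > 0" for i
      using w q by (simp add: W_def)
    define p where "p i = \<sigma> * W i powr (\<sigma> - 1)" for i
    define S where "S i = (\<Sum>k\<le>i. s k)" for i
    \<comment> \<open>Revenue lost by not having sold everything at the current price. Below,
      \<open>t\<close> and \<open>g\<close> are \<open>S\<close> and \<open>G\<close> in units of
      the current optimal quantity and its cost.\<close>
    define G where "G i = p i * S i - (\<Sum>k\<le>i. p k * s k)" for i
    define t where "t i = S i / W i" for i
    define g where "g i = G i / W i powr \<sigma>" for i
    have W\<sigma>: "W i powr \<sigma> = W i * W i powr (\<sigma> - 1)" for i
      using W[of i] powr_mult_base[of "W i" "\<sigma> - 1"] by simp
    have t: "t i \<ge> 0" if "i \<le> N" for i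
      using s that W[of i] by (auto simp: t_def S_def intro!: divide_nonneg_nonneg sum_nonneg)
    have gK: "g i + K \<le> \<sigma> * t i - t i powr \<sigma>" if "i \<le> N" for i
    proof -
      have "S i \<ge> 0"
        using t[OF that] W[of i] by (simp add: t_def zero_le_divide_iff)
      then have St: "S i powr \<sigma> = t i powr \<sigma> * W i powr \<sigma>"
        using W[of i] by (simp add: t_def powr_divide)
      have pS: "p i * S i = \<sigma> * t i * W i powr \<sigma>"
        using W[of i] by (simp add: t_def p_def W\<sigma>)
      have "K * W i powr \<sigma> \<le> p i * S i - G i - S i powr \<sigma>"
        using profit[OF that] by (simp add: W_def p_def S_def G_def)
      also have "G i = g i * W i powr \<sigma>"
        using W[of i] by (simp add: g_def)
      finally have "(g i + K) * W i powr \<sigma> \<le> (\<sigma> * t i - t i powr \<sigma>) * W i powr \<sigma>"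
        unfolding St pS by (simp add: algebra_simps)
      then show ?thesis
        using W[of i] by simp
    qed
    \<comment> \<open>The sale of step \<open>i + 1\<close> is at the new price and cancels in
      \<open>G\<close>; only the price rise on \<open>S i\<close> remains. The factor
      \<open>q powr \<sigma>\<close> is the change of unit.\<close>
    have step: "q powr \<sigma> * g (Suc i) = g i + \<sigma> * t i * (q powr (\<sigma> - 1) - 1)" for i
    proof -
      have WS: "W (Suc i) = q * W i"
        by (simp add: W_def)
      have "G (Suc i) = G i + S i * (p (Suc i) - p i)"
        by (simp add: G_def S_def algebra_simps)
      also have "p (Suc i) - p i = \<sigma> * W i powr (\<sigma> - 1) * (q powr (\<sigma> - 1) - 1)"
        using W[of i] q by (simp add: p_def WS powr_mult algebra_simps)
      also have "S i = t i * W i"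
        using W[of i] by (simp add: t_def)
      finally have "G (Suc i) = G i + \<sigma> * t i * (q powr (\<sigma> - 1) - 1) * W i powr \<sigma>"
        by (simp add: W\<sigma> algebra_simps)
      moreover have "G (Suc i) = q powr \<sigma> * g (Suc i) * W i powr \<sigma>"
        using W[of i] q by (simp add: g_def WS powr_mult)
      moreover have "G i = g i * W i powr \<sigma>"
        using W[of i] by (simp add: g_def)
      ultimately have "q powr \<sigma> * g (Suc i) * W i powr \<sigma>
          = (g i + \<sigma> * t i * (q powr (\<sigma> - 1) - 1)) * W i powr \<sigma>"
        by (simp add: algebra_simps)
      then show ?thesis
        using W[of i] by simp
    qed
    have increase: "g i + d \<le> g (Suc i)" if "i \<le> N" for i
    proof -
      \<comment> \<open>Once \<open>gK\<close> eliminates \<open>g i\<close>, the terms in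
        \<open>t i\<close> are \<open>a * t i powr \<sigma>\<close> minus a multiple of
        \<open>\<sigma> * (q - 1)\<close>. Bernoulli makes \<open>a\<close> a common factor, and the
        conjugate bound removes \<open>t i\<close>.\<close>
      have "\<sigma> * (q - 1) \<le> a"
        using bernoulli_powr[of \<sigma> q] assms q by (simp add: a_def)
      then have "q powr (\<sigma> - 1) * t i * (\<sigma> * (q - 1)) \<le> q powr (\<sigma> - 1) * t i * a"
        using t[OF that] by (intro mult_left_mono) auto
      also have "q powr (\<sigma> - 1) * t i * a \<le> (t i powr \<sigma> + q powr \<sigma> * L) * a"
        unfolding L_def using a assms t[OF that] q
        by (intro mult_right_mono alpha_star_tangent) auto
      finally have 1: "q powr (\<sigma> - 1) * t i * (\<sigma> * (q - 1)) \<le> (t i powr \<sigma> + q powr \<sigma> * L) * a" .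
      have 2: "a * g i \<le> a * (\<sigma> * t i - t i powr \<sigma> - K)"
        using gK[OF that] a by (intro mult_left_mono) auto
      have q1: "q powr \<sigma> = q * q powr (\<sigma> - 1)"
        using q powr_mult_base[of q "\<sigma> - 1"] by simp
      have "q powr \<sigma> * (g (Suc i) - g i) = \<sigma> * t i * (q powr (\<sigma> - 1) - 1) - a * g i"
        using step[of i] by (simp add: a_def algebra_simps)
      also have "\<dots> \<ge> \<sigma> * t i * (q powr (\<sigma> - 1) - 1) - a * (\<sigma> * t i - t i powr \<sigma> - K)"
        using 2 by simp
      also have "\<sigma> * t i * (q powr (\<sigma> - 1) - 1) - a * (\<sigma> * t i - t i powr \<sigma> - K)
          = a * (t i powr \<sigma> + K) - q powr (\<sigma> - 1) * t i * (\<sigma> * (q - 1))"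
        unfolding a_def q1 by (simp add: algebra_simps)
      also have "\<dots> \<ge> a * (K - q powr \<sigma> * L)"
        using 1 by (simp add: algebra_simps)
      also have "a * (K - q powr \<sigma> * L) = q powr \<sigma> * d"
        using q by (simp add: d_def)
      finally show ?thesis
        using q by simp
    qed
    have "i * d \<le> g i" if "i \<le> N" for i
      using that
    proof (induction i)
      case 0
      then show ?case
        by (simp add: g_def G_def S_def)
    next
      case (Suc i)
      then show ?case
        using increase[of i] by (simp add: algebra_simps)
    qed
    then have "N * d \<le> g N"
      by simp
    also have "g N \<le> \<sigma> * t N - t N powr \<sigma> - K"
      using gK[of N] by simp
    also have "\<dots> \<le> \<sigma> - 1 - K"
      using bernoulli_powr[of \<sigma> "t N"] t[of N] assms by (simp add: algebra_simps)
    finally show False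
      using N by simp
  qed
qed

section \<open>Reduction to the power cost function\<close>

lemma allocs_nth:
  assumes "x \<in> allocs"
  shows "0 \<le> x $ j" "x $ j \<le> 1"
proof -
  have nonneg: "0 \<le> x $ i" and sum: "(\<Sum>i\<in>UNIV. x $ i) \<le> 1" for i
    using assms by (auto simp: allocs_def)
  have "x $ j \<le> (\<Sum>i\<in>UNIV. x $ i)"
    using nonneg by (intro member_le_sum) auto
  then show "0 \<le> x $ j" "x $ j \<le> 1"
    using nonneg sum by auto
qed

text \<open>Costs are non-negative, so the sum of all values bounds the objective and the supremum
  is a genuine one.\<close>

lemma objective_le_OPT:
  fixes I :: "'n::finite demand list"
  assumes f: "\<And>y. 0 \<le> y \<Longrightarrow> 0 \<le> f y" and I: "valid_instance I"
    and xs: "length xs = length I" "set xs \<subseteq> allocs"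
  shows "objective f I xs \<le> OPT f I"
  unfolding OPT_def
proof (rule cSUP_upper)
  have bound: "objective f I ys \<le> (\<Sum>t<length I. \<Sum>j\<in>UNIV. fst (I ! t) $ j)"
    if ys: "length ys = length I" "set ys \<subseteq> allocs" for ys
  proof -
    have I: "0 \<le> fst (I ! t) $ j" "0 < snd (I ! t) $ j" if "t < length I" for t j
      using I nth_mem[OF that] by (auto simp: valid_instance_def case_prod_beta)
    have y: "0 \<le> ys ! t $ j" "ys ! t $ j \<le> 1" if "t < length I" for t j
      using ys that by (auto intro!: allocs_nth)
    have "0 \<le> f (\<Sum>t<length I. snd (I ! t) $ j * ys ! t $ j)" for j
      using I y by (intro f sum_nonneg mult_nonneg_nonneg) (auto intro: less_imp_le)
    then have "objective f I ys \<le> (\<Sum>t<length I. \<Sum>j\<in>UNIV. fst (I ! t) $ j * ys ! t $ j)"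
      unfolding objective_def by (simp add: sum_nonneg)
    also have "\<dots> \<le> (\<Sum>t<length I. \<Sum>j\<in>UNIV. fst (I ! t) $ j)"
      using I y by (intro sum_mono mult_left_le) auto
    finally show ?thesis .
  qed
  show "bdd_above (objective f I ` {xs. length xs = length I \<and> set xs \<subseteq> allocs})"
    using bound by (intro bdd_aboveI2) auto
qed (use xs in auto)

text \<open>A finite bound excludes the infinite case of \<open>perf_ratio\<close>, leaving a
  positive gain or both quantities zero.\<close>

lemma OPT_le_competitive_ratio:
  assumes "competitive_ratio f A \<le> ereal c" "valid_instance I"
  shows "OPT f I \<le> c * ALG f A I"
proof -
  have "perf_ratio (OPT f I) (ALG f A I) \<le> ereal c"
    using assms unfolding competitive_ratio_def by (meson SUP_le_iff mem_Collect_eq)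
  then show ?thesis
    by (auto simp: perf_ratio_def pos_divide_le_eq split: if_splits)
qed

section \<open>Instances with values at a single node\<close>

text \<open>The weights are the same at all nodes because validity requires them positive even where
  the value is 0.\<close>

definition single_node_instance ::
  "'n::finite \<Rightarrow> (nat \<Rightarrow> real) \<Rightarrow> (nat \<Rightarrow> real) \<Rightarrow> nat \<Rightarrow> 'n demand list" where
  "single_node_instance j v w n = map (\<lambda>k. (axis j (v k), \<chi> _. w k)) [0..<n]"

lemma objective_single_node_instance:
  "objective f (single_node_instance j v w n) xs =
    (\<Sum>t<n. v t * xs ! t $ j) - (\<Sum>i\<in>UNIV. f (\<Sum>t<n. w t * xs ! t $ i))"
proof -
  have "(\<Sum>i\<in>UNIV. axis j c $ i * x $ i) = c * x $ j" for c and x :: "real ^ 'a"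
    by (simp add: axis_def if_distrib[of "\<lambda>a. a * _"] cong: if_cong)
  then show ?thesis
    by (simp add: objective_def single_node_instance_def)
qed

lemma valid_single_node_instance:
  assumes "\<And>k. 0 \<le> v k" "\<And>k. 0 < w k"
  shows "valid_instance (single_node_instance j v w n)"
  using assms by (auto simp: valid_instance_def single_node_instance_def axis_def)

lemma online_algorithm_single_node_instance:
  assumes "online_algorithm A" "\<And>k. 0 \<le> v k" "\<And>k. 0 < w k"
  shows "A (single_node_instance j v w (Suc n)) \<in> allocs"
proof -
  have "single_node_instance j v w (Suc n) \<noteq> []"
    by (simp add: single_node_instance_def)
  then show ?thesis
    using assms valid_single_node_instance unfolding online_algorithm_def by blast
qed

text \<open>Witnessed by skipping the first \<open>n\<close> demands and giving the last one, at
  position \<open>n\<close>, wholly to \<open>j\<close>.\<close>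

lemma OPT_single_node_instance_ge:
  assumes f: "\<And>y. 0 \<le> y \<Longrightarrow> 0 \<le> f y" "f 0 = 0"
    and vw: "\<And>k. 0 \<le> v k" "\<And>k. 0 < w k"
  shows "v n - f (w n) \<le> OPT f (single_node_instance (j :: 'n::finite) v w (Suc n))"
proof -
  define xs :: "(real ^ 'n) list" where "xs = replicate n 0 @ [axis j 1]"
  have xs: "xs ! t = (if t = n then axis j 1 else 0)" if "t < Suc n" for t
    using that by (auto simp: xs_def nth_append)
  have "(\<Sum>t<Suc n. v t * xs ! t $ j) = v n"
    by (simp add: xs axis_def)
  moreover have "f (\<Sum>t<Suc n. w t * xs ! t $ i) = (if i = j then f (w n) else 0)" for i
    by (simp add: xs axis_def f)
  ultimately have "objective f (single_node_instance j v w (Suc n)) xs = v n - f (w n)"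
    unfolding objective_single_node_instance by simp
  moreover have "set xs \<subseteq> allocs"
    by (auto simp: xs_def allocs_def axis_def)
  then have "objective f (single_node_instance j v w (Suc n)) xs
      \<le> OPT f (single_node_instance j v w (Suc n))"
    by (intro objective_le_OPT f valid_single_node_instance vw)
      (auto simp: xs_def single_node_instance_def)
  ultimately show ?thesis
    by simp
qed

lemma ALG_single_node_instance_le:
  assumes f: "\<And>y. 0 \<le> y \<Longrightarrow> 0 \<le> f y"
    and vw: "\<And>k. 0 \<le> v k" "\<And>k. 0 < w k"
    and A: "online_algorithm A"
    and x: "\<And>t. x t = A (single_node_instance (j :: 'n::finite) v w (Suc t)) $ j"
  shows "ALG f A (single_node_instance j v w n) \<le> (\<Sum>t<n. v t * x t) - f (\<Sum>t<n. w t * x t)"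
proof -
  let ?I = "single_node_instance j v w"
  have len: "length (?I n) = n"
    by (simp add: single_node_instance_def)
  \<comment> \<open>Prefixes are shorter instances of the same family, so the decision at time
    \<open>t\<close> is the same for every stopping time \<open>n > t\<close>.\<close>
  have run: "run A (?I n) ! t = A (?I (Suc t))" if "t < n" for t
    using that by (auto simp: run_def len single_node_instance_def take_map min_def)
  have "0 \<le> A (?I (Suc t)) $ i" for t i
    by (intro allocs_nth online_algorithm_single_node_instance A vw)
  then have "0 \<le> f (\<Sum>t<n. w t * A (?I (Suc t)) $ i)" for i
    using vw by (intro f sum_nonneg mult_nonneg_nonneg) (auto intro: less_imp_le)
  then have "f (\<Sum>t<n. w t * x t) \<le> (\<Sum>i\<in>UNIV. f (\<Sum>t<n. w t * A (?I (Suc t)) $ i))"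
    unfolding x by (intro member_le_sum[of j UNIV "\<lambda>i. f (\<Sum>t<n. w t * A (?I (Suc t)) $ i)"]) auto
  moreover have "ALG f A (?I n) =
      (\<Sum>t<n. v t * x t) - (\<Sum>i\<in>UNIV. f (\<Sum>t<n. w t * A (?I (Suc t)) $ i))"
    by (simp add: ALG_def objective_single_node_instance run x)
  ultimately show ?thesis
    by simp
qed

section \<open>Transfer of the power game to elastic costs\<close>

text \<open>The algorithm's true cost is at least the power cost without any error; only the optimum
  loses a factor \<open>1 + \<delta>\<close>, absorbed by the gap below
  \<open>alpha_star \<sigma>\<close>.\<close>

lemma competitive_ratio_gt:
  fixes A :: "'n::finite algorithm"
  assumes \<sigma>: "1 < \<sigma>"
    and el: "elastic \<tau> \<sigma> f"
    and tight: "(SUP y\<in>{0<..}. elasticity (deriv f) y) = \<sigma> - 1"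
    and A: "online_algorithm A" and c: "c < alpha_star \<sigma>"
  shows "\<not> competitive_ratio f A \<le> ereal c"
proof
  assume "competitive_ratio f A \<le> ereal c"
  have alpha: "alpha_star \<sigma> > 0"
    using \<sigma> by (simp add: alpha_star_def)
  \<comment> \<open>Weakens the bound if necessary to make it positive.\<close>
  define b where "b = max c (alpha_star \<sigma> / 2)"
  have b: "0 < b" "b < alpha_star \<sigma>" "c \<le> b"
    using c alpha by (auto simp: b_def)
  with \<open>competitive_ratio f A \<le> ereal c\<close> have cr: "competitive_ratio f A \<le> ereal b"
    by (meson ereal_less_eq(3) order_trans)
  \<comment> \<open>The gap from \<open>c'\<close> to \<open>alpha_star \<sigma>\<close> feeds the
    power game, the gap from \<open>b\<close> to \<open>c'\<close> pays for approximating
    \<open>f\<close> by a power.\<close>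
  define c' where "c' = (b + alpha_star \<sigma>) / 2"
  have c': "c' > 0" "b < c'" "c' < alpha_star \<sigma>"
    using b by (auto simp: c'_def)
  define K where "K = (\<sigma> - 1) / c'"
  have "(\<sigma> - 1) / alpha_star \<sigma> < K"
    using \<sigma> c' unfolding K_def by (intro divide_strict_left_mono) auto
  then obtain q :: real and N :: nat where q: "1 < q"
    and game: "\<And>w s. 0 < w \<Longrightarrow> (\<And>i. i \<le> N \<Longrightarrow> 0 \<le> s i) \<Longrightarrow>
      \<exists>i\<le>N. (\<Sum>k\<le>i. \<sigma> * (w * q ^ k) powr (\<sigma> - 1) * s k) - (\<Sum>k\<le>i. s k) powr \<sigma>
        < K * (w * q ^ i) powr \<sigma>"
    using power_game[OF \<sigma>] by blast
  \<comment> \<open>Keeps all quantities within \<open>[w, 1]\<close> and their total at most 1, the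
    range of the two comparisons; the extra 1 ensures \<open>w < 1\<close>.\<close>
  define w where "w = 1 / (1 + (\<Sum>k\<le>N. q ^ k))"
  have sum_pos: "(\<Sum>k\<le>N. q ^ k) > 0"
    using q by (intro sum_pos) auto
  then have w: "0 < w" "w < 1"
    by (auto simp: w_def)
  \<comment> \<open>Solves \<open>b * K = \<sigma> - 1 - \<delta>\<close>, which closes the
    contradiction at the end.\<close>
  define \<delta> where "\<delta> = (\<sigma> - 1) * (1 - b / c')"
  have \<delta>: "\<delta> > 0"
    using \<sigma> c' by (simp add: \<delta>_def)
  obtain x where x: "0 < x"
    and fx: "\<And>y. w \<le> y \<Longrightarrow> y \<le> 1 \<Longrightarrow> f (x * y) \<le> (1 + \<delta>) * y powr \<sigma> * f x"
    using elastic_asymptotic_power[OF el tight w \<delta>] by blast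
  have f0: "f 0 = 0" and fnn: "\<And>y. 0 \<le> y \<Longrightarrow> 0 \<le> f y" and "strict_mono_on {0..} f"
    using el by (auto simp: elastic_def)
  then have fpos: "f x > 0"
    using strict_mono_onD[of "{0..}" f 0 x] x by simp
  define W where "W k = w * q ^ k" for k
  define p where "p k = \<sigma> * W k powr (\<sigma> - 1)" for k
  have W: "W k > 0" "w \<le> W k" for k
    using w q by (auto simp: W_def)
  have sumW: "(\<Sum>k\<le>N. W k) \<le> 1"
    unfolding W_def sum_distrib_left[symmetric] using sum_pos by (simp add: w_def)
  have pW: "p k * W k = \<sigma> * W k powr \<sigma>" for k
    using W[of k] powr_mult_base[of "W k" "\<sigma> - 1"] by (simp add: p_def mult.commute)
  \<comment> \<open>In units of \<open>x\<close> for quantity and \<open>f x\<close> for money,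
    demand \<open>k\<close> offers quantity \<open>W k\<close> at unit price \<open>p k\<close>. The
    node is arbitrary.\<close>
  define I :: "nat \<Rightarrow> 'n demand list" where
    "I = single_node_instance undefined (\<lambda>k. f x * p k * W k) (\<lambda>k. x * W k)"
  define s where "s k = W k * A (I (Suc k)) $ undefined" for k
  have vnn: "0 \<le> f x * p k * W k" and wpos: "0 < x * W k" for k
    using fpos W[of k] x \<sigma> by (auto simp: p_def)
  have valid: "valid_instance (I n)" for n
    unfolding I_def by (intro valid_single_node_instance vnn wpos)
  have A01: "0 \<le> A (I (Suc k)) $ undefined" "A (I (Suc k)) $ undefined \<le> 1" for k
    unfolding I_def by (intro allocs_nth online_algorithm_single_node_instance A vnn wpos)+
  have s: "0 \<le> s k" "s k \<le> W k" for k
    using A01[of k] W[of k] by (auto simp: s_def mult_left_le)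
  \<comment> \<open>All \<open>s k\<close> are fixed before \<open>i\<close> is chosen, so stopping
    after demand \<open>i\<close> leaves the earlier decisions unchanged.\<close>
  obtain i where i: "i \<le> N" and less: "(\<Sum>k\<le>i. p k * s k) - (\<Sum>k\<le>i. s k) powr \<sigma> < K * W i powr \<sigma>"
    using game[OF w(1), of s] s(1) by (auto simp: p_def W_def)
  have S: "0 \<le> (\<Sum>k\<le>i. s k)" "(\<Sum>k\<le>i. s k) \<le> 1"
  proof -
    have "(\<Sum>k\<le>i. s k) \<le> (\<Sum>k\<le>i. W k)"
      by (intro sum_mono s)
    also have "\<dots> \<le> (\<Sum>k\<le>N. W k)"
      using i W by (intro sum_mono2) (auto intro: less_imp_le)
    finally show "(\<Sum>k\<le>i. s k) \<le> 1"
      using sumW by simp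
  qed (simp add: sum_nonneg s)
  have Wi: "W i \<le> 1"
    using member_le_sum[of i "{..N}" W] i W sumW by (force intro: less_imp_le)
  have "ALG f A (I (Suc i)) \<le> (\<Sum>k<Suc i. f x * p k * W k * A (I (Suc k)) $ undefined)
      - f (\<Sum>k<Suc i. x * W k * A (I (Suc k)) $ undefined)"
    unfolding I_def by (intro ALG_single_node_instance_le fnn vnn wpos A refl)
  also have "(\<Sum>k<Suc i. f x * p k * W k * A (I (Suc k)) $ undefined) = f x * (\<Sum>k\<le>i. p k * s k)"
    unfolding lessThan_Suc_atMost by (simp add: s_def sum_distrib_left mult_ac)
  also have "(\<Sum>k<Suc i. x * W k * A (I (Suc k)) $ undefined) = x * (\<Sum>k\<le>i. s k)"
    unfolding lessThan_Suc_atMost by (simp add: s_def sum_distrib_left mult_ac)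
  also have "f x * (\<Sum>k\<le>i. p k * s k) - f (x * (\<Sum>k\<le>i. s k))
      \<le> f x * ((\<Sum>k\<le>i. p k * s k) - (\<Sum>k\<le>i. s k) powr \<sigma>)"
    using elastic_lower[OF el tight x S] by (simp add: algebra_simps)
  also have "\<dots> < f x * (K * W i powr \<sigma>)"
    using less fpos by simp
  finally have ALG: "ALG f A (I (Suc i)) < f x * (K * W i powr \<sigma>)" .
  have "(\<sigma> - 1 - \<delta>) * W i powr \<sigma> * f x \<le> f x * (p i * W i) - f (x * W i)"
    unfolding pW using fx[OF W(2) Wi] by (simp add: algebra_simps)
  also have "f x * (p i * W i) = f x * p i * W i"
    by simp
  also have "f x * p i * W i - f (x * W i) \<le> OPT f (I (Suc i))"
    unfolding I_def by (intro OPT_single_node_instance_ge fnn f0 vnn wpos)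
  also have "\<dots> \<le> b * ALG f A (I (Suc i))"
    by (rule OPT_le_competitive_ratio[OF cr valid])
  also have "\<dots> < b * (f x * (K * W i powr \<sigma>))"
    using ALG b by simp
  also have "b * (f x * (K * W i powr \<sigma>)) = (\<sigma> - 1 - \<delta>) * W i powr \<sigma> * f x"
    using c' by (simp add: \<delta>_def K_def field_simps)
  finally show False
    by simp
qed

theorem theorem1:
  fixes \<sigma> \<tau> :: real and f :: "real \<Rightarrow> real"
  assumes "1 \<le> \<tau>" and "\<tau> \<le> \<sigma>" and "1 < \<sigma>"
    and elastic: "elastic \<tau> \<sigma> f"
    and sigma_tight: "(SUP y\<in>{0<..}. elasticity (deriv f) y) = \<sigma> - 1"
  shows "\<forall>\<epsilon>>0. \<not> (\<exists>A :: 'n::finite algorithm.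
    online_algorithm A \<and> competitive_ratio f A \<le> ereal (alpha_star \<sigma> - \<epsilon>))"
proof (intro allI impI notI, elim exE conjE)
  fix \<epsilon> :: real and A :: "'n algorithm"
  assume "0 < \<epsilon>" "online_algorithm A" "competitive_ratio f A \<le> ereal (alpha_star \<sigma> - \<epsilon>)"
  then show False
    using competitive_ratio_gt[OF assms(3) elastic sigma_tight, of A "alpha_star \<sigma> - \<epsilon>"] by simp
qed

end
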